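(* Let $n$ be a positive integer, let $\mathbb{K}$ be a semifield, and let $u\in\mathbb{K}^n$. Let $\mathbf{f}_u:\mathbb{K}^n\to\mathbb{K}^n$ be the map defined in the context. (a) The map $\mathbf{f}_u$ is an involution (i.e., $\mathbf{f}_u\circ\mathbf{f}_u=\operatorname{id}$). (b) Let $x,y\in\mathbb{K}^n$ be such that $y=\mathbf{f}_u(x)$. Then $$y_1y_2\cdots y_n\cdot x_1x_2\cdots x_n=(u_1u_2\cdots u_n)^2.$$ (c) Let $x,y\in\mathbb{K}^n$ be such that $y=\mathbf{f}_u(x)$. Then, for each $i\in\mathbb{Z}$, $$(u_i+x_i)\left(\frac{1}{u_{i+1}}+\frac{1}{x_{i+1}}\right)=(u_i+y_i)\left(\frac{1}{u_{i+1}}+\frac{1}{y_{i+1}}\right).$$ (d) Let $x,y\in\mathbb{K}^n$ be such that $y=\mathbf{f}_u(x)$. Then $$\prod_{i=1}^n\frac{u_i+x_i}{x_i}=\prod_{i=1}^n\frac{u_i+y_i}{u_i}.$$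
   Context: A semifield is a set $\mathbb{K}$ with two binary operations $+$ and $\cdot$ and an element $1$ such that $(\mathbb{K},+)$ is a commutative semigroup (no zero element required), $(\mathbb{K},\cdot,1)$ is an abelian group, and $\cdot$ distributes over $+$. We write $a/b=\frac{a}{b}=ab^{-1}$; empty products equal $1$. Index convention: for an $n$-tuple $a\in\mathbb{K}^n$ and $i\in\mathbb{Z}$, $a_i$ denotes the $i'$-th entry of $a$, where $i'\in\{1,\ldots,n\}$ is the unique element with $i'\equiv i\bmod n$. Definition of $\mathbf{f}_u$: Let $x\in\mathbb{K}^n$. For each $j\in\mathbb{Z}$ and $r\in\mathbb{N}=\{0,1,2,\ldots\}$, set $t_{r,j}=\sum_{k=0}^{r}\left(\prod_{i=1}^{k}x_{j+i}\right)\left(\prod_{i=k+1}^{r}u_{j+i}\right)\in\mathbb{K}$. Define $y\in\mathbb{K}^n$ by $y_i=u_i\cdot\dfrac{u_{i-1}t_{n-1,i-1}}{x_{i+1}t_{n-1,i+1}}$ for each $i\in\{1,\ldots,n\}$. Set $\mathbf{f}_u(x)=y$. *)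

theory Defs
  imports "HOL-Library.FuncSet" "HOL-Number_Theory.Cong"
begin

text \<open>A semifield has no zero: \<^class>\<open>comm_semiring\<close> only asks for a commutative semigroup under
  addition. In particular every element is invertible, and \<^const>\<open>sum\<close> is not available.\<close>

class semifield = comm_semiring + comm_monoid_mult + inverse +
  assumes semifield_left_inverse: "inverse a * a = 1"
    and semifield_divide_inverse: "a / b = a * inverse b"

text \<open>The sum \<open>f 0 + \<dots> + f r\<close>, which is never empty and hence needs no zero.\<close>

primrec sum_upto :: "(nat \<Rightarrow> 'a::ab_semigroup_add) \<Rightarrow> nat \<Rightarrow> 'a" where
  "sum_upto f 0 = f 0"
| "sum_upto f (Suc r) = sum_upto f r + f (Suc r)"

text \<open>An \<open>n\<close>-tuple is a function that is \<^const>\<open>undefined\<close> outside \<open>{1..n}\<close>, so that equality of tuples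
  is equality of their entries. Indices are integers because of the cyclic indexing below.\<close>

definition tuples :: "nat \<Rightarrow> (int \<Rightarrow> 'a) set" where
  "tuples n = {1..int n} \<rightarrow>\<^sub>E UNIV"

definition cyc_index :: "nat \<Rightarrow> int \<Rightarrow> int" where
  "cyc_index n i = (THE i'. i' \<in> {1..int n} \<and> [i' = i] (mod int n))"

definition entry :: "nat \<Rightarrow> (int \<Rightarrow> 'a) \<Rightarrow> int \<Rightarrow> 'a" where
  "entry n a i = a (cyc_index n i)"

lemma cyc_index_unique:
  assumes "n > 0"
  shows "\<exists>!i'. i' \<in> {1..int n} \<and> [i' = i] (mod int n)"
proof (rule ex1I)
  show "(i - 1) mod int n + 1 \<in> {1..int n} \<and> [(i - 1) mod int n + 1 = i] (mod int n)"
    using assms pos_mod_bound[of "int n" "i - 1"]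
    by (auto simp: cong_def mod_simps add1_zle_eq simp del: pos_mod_bound)
next
  fix j assume j: "j \<in> {1..int n} \<and> [j = i] (mod int n)"
  then have "(j - 1) mod int n = (i - 1) mod int n"
    unfolding cong_def by (metis mod_diff_left_eq)
  moreover have "(j - 1) mod int n = j - 1"
    using j by (intro mod_pos_pos_trivial) auto
  ultimately show "j = (i - 1) mod int n + 1"
    by simp
qed

lemma cyc_index_eq:
  assumes "i \<in> {1..int n}"
  shows "cyc_index n i = i"
proof -
  have "n > 0" using assms by auto
  then show ?thesis
    unfolding cyc_index_def using assms by (intro the1_equality cyc_index_unique) auto
qed

definition t_elem ::
    "nat \<Rightarrow> (int \<Rightarrow> 'a::semifield) \<Rightarrow> (int \<Rightarrow> 'a) \<Rightarrow> nat \<Rightarrow> int \<Rightarrow> 'a" where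
  "t_elem n u x r j =
     sum_upto (\<lambda>k. (\<Prod>i\<in>{1..k}. entry n x (j + int i)) *
                   (\<Prod>i\<in>{k+1..r}. entry n u (j + int i))) r"

definition f_map :: "nat \<Rightarrow> (int \<Rightarrow> 'a::semifield) \<Rightarrow> (int \<Rightarrow> 'a) \<Rightarrow> (int \<Rightarrow> 'a)" where
  "f_map n u x =
     (\<lambda>i\<in>{1..int n}. entry n u i *
        ((entry n u (i - 1) * t_elem n u x (n - 1) (i - 1)) /
         (entry n x (i + 1) * t_elem n u x (n - 1) (i + 1))))"

end

theory Submission
  imports Defs
begin

text \<open>
  Write \<open>s j\<close> for \<open>t\<^bsub>n-1,j\<^esub>\<close>, and \<open>A\<close>, \<open>B\<close> for the products of all entries of \<open>u\<close> and of \<open>x\<close>.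
  Splitting off the first or the last step of \<open>t\<^bsub>n-1,j\<^esub>\<close> and using periodicity gives, for
  \<open>n \<ge> 2\<close>, an element \<open>V j\<close> with
  \<open>u j * s j = A + V j\<close> and \<open>x (j + 1) * s (j + 1) = B + V j\<close>.
  Over a field one would conclude that \<open>u j * s j - x (j + 1) * s (j + 1)\<close> does not depend on \<open>j\<close>;
  a semifield need not be cancellative under addition (think of the tropical one), but comparing
  two indices still gives the exchange identity
  \<open>u i * s i + x (j + 1) * s (j + 1) = u j * s j + x (i + 1) * s (i + 1)\<close>
  (\<open>exchange\<close>), from which everything follows.

  Taking \<open>j = i - 1\<close> there gives
  \<open>(u i + x i) * s i = u (i - 1) * s (i - 1) + x (i + 1) * s (i + 1)\<close>,
  which says that
  \<open>(u i + y i) / u i = (u i + x i) * s i / (x (i + 1) * s (i + 1))\<close>.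
  In part (c) the factors \<open>s\<close> cancel between neighbours, and in part (d) they cancel around the
  cycle. Part (b) is the same cancellation applied to the definition of \<open>y\<close>.

  For part (a) one needs the sums \<open>s'\<close> formed from \<open>y\<close> in place of \<open>x\<close>. Requiring that \<open>x\<close> be
  recovered from \<open>y\<close> suggests that \<open>u j * s' j\<close> be proportional to \<open>x (j + 1) * s (j + 1)\<close>. The
  factor is \<open>A / B\<close>, and the formula is the case \<open>r = n - 1\<close> of a closed form for all the partial
  sums \<open>t\<^bsub>r,j\<^esub>\<close> of \<open>y\<close> (\<open>tsum_y\<close>), which is proved by induction on \<open>r\<close>. Its induction step
  rests on \<open>exchange_long\<close>, a version of the exchange identity for long sums.
\<close>

section \<open>Semifields\<close>

lemma semifield_cancel_left: "(c::'a::semifield) * a = c * b \<longleftrightarrow> a = b"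
  by (metis mult.assoc mult_1 semifield_left_inverse)

lemma semifield_cancel_right: "(a::'a::semifield) * c = b * c \<longleftrightarrow> a = b"
  using semifield_cancel_left[of c a b] by (simp add: mult.commute)

lemma semifield_divide_mult [simp]: "(a::'a::semifield) / b * b = a"
  by (simp add: semifield_divide_inverse mult.assoc semifield_left_inverse)

lemma semifield_mult_divide [simp]: "(b::'a::semifield) * (a / b) = a"
  by (metis mult.commute semifield_divide_mult)

lemma sum_of_inverses:
  fixes a b :: "'a::semifield"
  shows "(1 / a + 1 / b) * (a * b) = a + b"
proof -
  have "(1 / a + 1 / b) * (a * b) = (1 / a * a) * b + (1 / b * b) * a"
    unfolding distrib_right by (simp only: ac_simps)
  then show ?thesis
    by (simp add: add.commute)
qed

section \<open>Consecutive products and the sums \<open>t\<close> for sequences\<close>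

lemma sum_upto_cong:
  assumes "\<And>k. k \<le> r \<Longrightarrow> f k = g k"
  shows "sum_upto f r = sum_upto g r"
  using assms by (induction r) auto

lemma sum_upto_mult_right:
  fixes c :: "'a::comm_semiring"
  shows "sum_upto (\<lambda>k. f k * c) r = sum_upto f r * c"
  by (induction r) (auto simp: distrib_right)

definition block :: "(int \<Rightarrow> 'a::comm_monoid_mult) \<Rightarrow> nat \<Rightarrow> int \<Rightarrow> 'a" where
  "block f r j = (\<Prod>i\<in>{1..r}. f (j + int i))"

text \<open>
  The proof works with sequences indexed by all integers. For \<open>n\<close>-tuples extended periodically
  this is \<^const>\<open>t_elem\<close>.
\<close>

definition tsum :: "(int \<Rightarrow> 'a::semifield) \<Rightarrow> (int \<Rightarrow> 'a) \<Rightarrow> nat \<Rightarrow> int \<Rightarrow> 'a" where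
  "tsum u x r j = sum_upto (\<lambda>k. block x k j * (\<Prod>i\<in>{k+1..r}. u (j + int i))) r"

lemma t_elem_eq_tsum: "t_elem n u x r j = tsum (entry n u) (entry n x) r j"
  by (simp add: t_elem_def tsum_def block_def)

lemma block_0 [simp]: "block f 0 j = 1"
  by (simp add: block_def)

lemma block_Suc: "block f (Suc r) j = block f r j * f (j + int r + 1)"
  by (simp add: block_def prod.nat_ivl_Suc' mult.commute ac_simps)

lemma block_Suc_left: "block f (Suc r) j = f (j + 1) * block f r (j + 1)"
proof (induction r)
  case 0
  then show ?case by (simp add: block_Suc)
next
  case (Suc r)
  have "j + int (Suc r) + 1 = j + 1 + int r + 1"
    by simp
  then show ?case
    by (simp only: block_Suc[of f "Suc r" j] block_Suc[of f r "j + 1"] Suc mult.assoc)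
qed

lemma prod_eq_block: "(\<Prod>i\<in>{1..int n}. f i) = block f n 0"
proof -
  have "{1..int n} = int ` {1..n}"
    using image_int_atLeastAtMost[of 1 n] by simp
  then have "(\<Prod>i\<in>{1..int n}. f i) = (\<Prod>i\<in>int ` {1..n}. f i)"
    by simp
  also have "\<dots> = block f n 0"
    by (subst prod.reindex) (auto simp: block_def)
  finally show ?thesis .
qed

text \<open>
  The block of length \<open>n + 1\<close> from \<open>j\<close> contains the blocks of length \<open>n\<close> from \<open>j\<close> and \<open>j + 1\<close>; what
  is left over is the same factor in both cases.
\<close>

lemma block_period:
  fixes f :: "int \<Rightarrow> 'a::semifield"
  assumes "\<And>i. f (i + int n) = f i"
  shows "block f n j = (\<Prod>i\<in>{1..int n}. f i)"
proof -
  have step: "block f n (j + 1) = block f n j" for j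
  proof -
    have "f (j + 1) * block f n (j + 1) = block f n j * f (j + int n + 1)"
      using block_Suc[of f n j] block_Suc_left[of f n j] by simp
    also have "f (j + int n + 1) = f (j + 1)"
      using assms[of "j + 1"] by (simp add: ac_simps)
    finally show ?thesis
      by (simp add: mult.commute[of _ "f (j + 1)"] semifield_cancel_left)
  qed
  have "block f n j = block f n 0"
  proof (induction j rule: int_induct[where k = 0])
    case (step2 i)
    then show ?case using step[of "i - 1"] by simp
  qed (simp_all add: step)
  then show ?thesis by (simp add: prod_eq_block)
qed

lemma prod_shift:
  fixes f :: "int \<Rightarrow> 'a::semifield"
  assumes "\<And>i. f (i + int n) = f i"
  shows "(\<Prod>i\<in>{1..int n}. f (i + c)) = (\<Prod>i\<in>{1..int n}. f i)"
proof -
  have "(\<Prod>i\<in>{1..int n}. f (i + c)) = block f n c"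
    by (simp add: prod_eq_block block_def ac_simps)
  then show ?thesis using assms by (simp add: block_period)
qed

lemma tsum_0 [simp]: "tsum u x 0 j = 1"
  by (simp add: tsum_def)

lemma tsum_Suc: "tsum u x (Suc r) j = tsum u x r j * u (j + int r + 1) + block x (Suc r) j"
proof -
  have "sum_upto (\<lambda>k. block x k j * (\<Prod>i\<in>{k+1..Suc r}. u (j + int i))) r =
        sum_upto (\<lambda>k. block x k j * (\<Prod>i\<in>{k+1..r}. u (j + int i)) * u (j + int r + 1)) r"
    by (rule sum_upto_cong) (simp add: prod.nat_ivl_Suc' ac_simps)
  then show ?thesis
    by (simp add: tsum_def sum_upto_mult_right)
qed

lemma tsum_Suc_left: "tsum u x (Suc r) j = block u (Suc r) j + x (j + 1) * tsum u x r (j + 1)"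
proof (induction r)
  case 0
  then show ?case by (simp add: tsum_Suc block_Suc)
next
  case (Suc r)
  have "tsum u x (Suc (Suc r)) j =
      (block u (Suc r) j + x (j + 1) * tsum u x r (j + 1)) * u (j + int r + 2)
      + x (j + 1) * block x (Suc r) (j + 1)"
    using tsum_Suc[of u x "Suc r" j] Suc block_Suc_left[of x "Suc r" j] by (simp add: ac_simps)
  also have "\<dots> = block u (Suc (Suc r)) j + x (j + 1) * tsum u x (Suc r) (j + 1)"
    using block_Suc[of u "Suc r" j] tsum_Suc[of u x r "j + 1"]
    by (simp add: distrib_left distrib_right ac_simps)
  finally show ?case .
qed

section \<open>The map on periodic sequences\<close>

locale periodic_pair =
  fixes n :: nat and u x :: "int \<Rightarrow> 'a::semifield"
  assumes n_pos: "n > 0"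
    and u_period: "u (i + int n) = u i"
    and x_period: "x (i + int n) = x i"
begin

definition s :: "int \<Rightarrow> 'a" where
  "s j = tsum u x (n - 1) j"

definition y :: "int \<Rightarrow> 'a" where
  "y i = u i * (u (i - 1) * s (i - 1) / (x (i + 1) * s (i + 1)))"

abbreviation "A \<equiv> \<Prod>i\<in>{1..int n}. u i"
abbreviation "B \<equiv> \<Prod>i\<in>{1..int n}. x i"

lemma s_period: "s (i + int n) = s i"
proof -
  have "u (i + int n + int k) = u (i + int k)" "x (i + int n + int k) = x (i + int k)" for k
    using u_period[of "i + int k"] x_period[of "i + int k"] by (simp_all add: ac_simps)
  then show ?thesis
    by (simp add: s_def tsum_def block_def)
qed

lemma y_period: "y (i + int n) = y i"
  using u_period[of i] u_period[of "i - 1"] x_period[of "i + 1"]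
    s_period[of "i - 1"] s_period[of "i + 1"]
  by (simp add: y_def algebra_simps)

lemma y_mult: "y i * (x (i + 1) * s (i + 1)) = u i * (u (i - 1) * s (i - 1))"
  by (simp add: y_def mult.assoc)

text \<open>
  For \<open>n \<ge> 2\<close>, both \<open>u j * s j\<close> and \<open>x (j + 1) * s (j + 1)\<close> contain the common part
  \<open>V j = u j * x (j + 1) * t\<^bsub>n-2,j+1\<^esub>\<close>, and the remaining term is the full product \<open>A\<close> respectively
  \<open>B\<close>. For \<open>n = 1\<close> there is no common part, but all sequences are constant.
\<close>

lemma exchange:
  "u i * s i + x (j + 1) * s (j + 1) = u j * s j + x (i + 1) * s (i + 1)"
proof (cases "n = 1")
  case True
  have const: "f i = f 0" if "\<And>i. f (i + int n) = f i" for f :: "int \<Rightarrow> 'a" and i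
  proof (induction i rule: int_induct[where k = 0])
    case (step2 i)
    then show ?case using that[of "i - 1"] True by simp
  qed (use that True in simp_all)
  show ?thesis
    using const[of u, OF u_period] const[of x, OF x_period] const[of s, OF s_period]
    by (metis (no_types))
next
  case False
  then obtain r where n: "n = Suc (Suc r)"
    using n_pos by (metis One_nat_def gr0_conv_Suc not0_implies_Suc)
  have s_Suc: "s j = tsum u x (Suc r) j" for j
    unfolding s_def by (simp add: n)
  define V where "V j = u j * x (j + 1) * tsum u x r (j + 1)" for j
  have left: "u j * s j = A + V j" for j
  proof -
    have full: "u j * block u (Suc r) j = A"
      using block_Suc_left[of u "Suc r" "j - 1"] block_period[of u n "j - 1", OF u_period] n
      by simp
    show ?thesis
      by (simp only: s_Suc tsum_Suc_left V_def distrib_left full mult.assoc)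
  qed
  have right: "x (j + 1) * s (j + 1) = B + V j" for j
  proof -
    have full: "x (j + 1) * block x (Suc r) (j + 1) = B"
      using block_Suc_left[of x "Suc r" j] block_period[of x n j, OF x_period] n by simp
    have wrap: "u (j + 1 + int r + 1) = u j"
      using u_period[of j] n by (simp add: ac_simps)
    show ?thesis
      unfolding s_Suc tsum_Suc V_def distrib_left wrap full by (simp only: ac_simps)
  qed
  show ?thesis
    unfolding left right by (simp only: ac_simps)
qed

lemma three_term: "(u i + x i) * s i = u (i - 1) * s (i - 1) + x (i + 1) * s (i + 1)"
  using exchange[of i "i - 1"] by (simp add: distrib_right)

lemma u_plus_y: "(u i + y i) * (x (i + 1) * s (i + 1)) = u i * ((u i + x i) * s i)"
  unfolding distrib_right[of "u i" "y i"] y_mult three_term distrib_left by (rule add.commute)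

section \<open>Products around the cycle\<close>

lemma prod_y: "(\<Prod>i\<in>{1..int n}. y i) * B = A ^ 2"
proof -
  let ?S = "\<Prod>i\<in>{1..int n}. s i"
  have "(\<Prod>i\<in>{1..int n}. y i * (x (i + 1) * s (i + 1))) =
        (\<Prod>i\<in>{1..int n}. u i * (u (i + -1) * s (i + -1)))"
    by (simp add: y_mult)
  then have "(\<Prod>i\<in>{1..int n}. y i) * (B * ?S) = A * (A * ?S)"
    unfolding prod.distrib
    by (simp only: prod_shift[of x, OF x_period] prod_shift[of u, OF u_period]
        prod_shift[of s, OF s_period])
  then have "((\<Prod>i\<in>{1..int n}. y i) * B) * ?S = A ^ 2 * ?S"
    by (simp add: power2_eq_square ac_simps)
  then show ?thesis
    by (simp add: semifield_cancel_right)
qed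

lemma prod_ratio:
  "(\<Prod>i\<in>{1..int n}. (u i + x i) / x i) = (\<Prod>i\<in>{1..int n}. (u i + y i) / u i)"
proof -
  let ?S = "\<Prod>i\<in>{1..int n}. s i"
  have "(u i + y i) / u i * (x (i + 1) * s (i + 1)) = ((u i + x i) / x i) * (x i * s i)" for i
  proof -
    have "u i * ((u i + y i) / u i * (x (i + 1) * s (i + 1)))
        = u i * ((u i + y i) / u i) * (x (i + 1) * s (i + 1))"
      by (simp only: mult.assoc)
    also have "\<dots> = u i * (((u i + x i) / x i * x i) * s i)"
      by (simp add: u_plus_y)
    finally show ?thesis
      by (simp only: semifield_cancel_left mult.assoc)
  qed
  then have "(\<Prod>i\<in>{1..int n}. (u i + y i) / u i * (x (i + 1) * s (i + 1))) =
        (\<Prod>i\<in>{1..int n}. (u i + x i) / x i * (x i * s i))"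
    by simp
  then have "(\<Prod>i\<in>{1..int n}. (u i + y i) / u i) * (B * ?S) =
        (\<Prod>i\<in>{1..int n}. (u i + x i) / x i) * (B * ?S)"
    unfolding prod.distrib
    by (simp only: prod_shift[of x, OF x_period] prod_shift[of s, OF s_period])
  then show ?thesis
    by (simp add: semifield_cancel_right)
qed

section \<open>The local invariant\<close>

lemma local_invariant:
  "(u i + x i) * (1 / u (i + 1) + 1 / x (i + 1)) = (u i + y i) * (1 / u (i + 1) + 1 / y (i + 1))"
proof -
  let ?L = "(u i + x i) * (1 / u (i + 1) + 1 / x (i + 1))"
  let ?R = "(u i + y i) * (1 / u (i + 1) + 1 / y (i + 1))"
  let ?v = "u (i + 1)" and ?z = "x (i + 1)" and ?w = "y (i + 1)"
  let ?Q = "x (i + 1 + 1) * s (i + 1 + 1)"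
  have y_next: "?w * ?Q = ?v * (u i * s i)"
    using y_mult[of "i + 1"] by simp
  have L: "?L * (?v * ?z) = (u i + x i) * (?v + ?z)"
    by (simp add: mult.assoc sum_of_inverses)
  \<comment> \<open>The last factor is the product of the denominators of \<open>y i\<close> and \<open>y (i + 1)\<close>.\<close>
  have "?R * (?v * ?w * (?z * s (i + 1) * ?Q)) =
      ((u i + y i) * (?z * s (i + 1))) * (((1 / ?v + 1 / ?w) * (?v * ?w)) * ?Q)"
    by (simp only: ac_simps)
  also have "\<dots> = (u i * ((u i + x i) * s i)) * (?v * ((?v + ?z) * s (i + 1)))"
    using u_plus_y[of "i + 1"] by (simp only: u_plus_y sum_of_inverses)
  also have "\<dots> = ((u i + x i) * (?v + ?z)) * (s (i + 1) * (?v * (u i * s i)))"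
    by (simp only: ac_simps)
  also have "\<dots> = ?L * (?v * ?w * (?z * s (i + 1) * ?Q))"
    unfolding L[symmetric] y_next[symmetric] by (simp only: ac_simps)
  finally show ?thesis
    by (simp only: semifield_cancel_right)
qed

section \<open>Involutivity\<close>

text \<open>
  The case \<open>r = 0\<close> is \<open>three_term\<close>. The induction splits off the first step of the long
  sums and keeps the right end \<open>m = j + r + 1\<close> in place, because then the terms that
  still have to be matched after using the induction hypothesis form a multiple of \<open>exchange\<close> for
  \<open>m\<close> and \<open>j\<close>.
\<close>

lemma exchange_long:
  "tsum u x (Suc r) j * s (j + int r + 1) =
   x (j + int r + 2) * s (j + int r + 2) * tsum u x r j + block u (Suc r) (j - 1) * s j"
proof (induction r arbitrary: j)
  case 0
  show ?case
    using three_term[of "j + 1"] by (simp add: tsum_Suc block_Suc add.commute)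
next
  case (Suc r)
  define m where "m = j + int r + 2"
  let ?U = "block u (Suc r) j"
  have IH: "tsum u x (Suc r) (j + 1) * s m =
      x (m + 1) * s (m + 1) * tsum u x r (j + 1) + ?U * s (j + 1)"
    using Suc[of "j + 1"] by (simp add: m_def ac_simps)
  have split_u: "block u (Suc (Suc r)) j = ?U * u m" "block u (Suc (Suc r)) (j - 1) = u j * ?U"
    using block_Suc[of u "Suc r" j] block_Suc_left[of u "Suc r" "j - 1"]
    by (simp_all add: m_def ac_simps)
  have "tsum u x (Suc (Suc r)) j * s m =
      ?U * u m * s m + x (j + 1) * (tsum u x (Suc r) (j + 1) * s m)"
    by (simp only: tsum_Suc_left[of u x "Suc r" j] split_u distrib_right mult.assoc)
  also have "\<dots> = x (j + 1) * (x (m + 1) * s (m + 1) * tsum u x r (j + 1))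
      + ?U * (u m * s m + x (j + 1) * s (j + 1))"
    unfolding IH by (simp only: distrib_left ac_simps)
  also have "\<dots> = x (j + 1) * (x (m + 1) * s (m + 1) * tsum u x r (j + 1))
      + ?U * (u j * s j + x (m + 1) * s (m + 1))"
    by (simp only: exchange[of m j])
  also have "\<dots> = x (m + 1) * s (m + 1) * tsum u x (Suc r) j
      + block u (Suc (Suc r)) (j - 1) * s j"
    by (simp only: tsum_Suc_left[of u x r j] split_u distrib_left ac_simps)
  finally show ?case
    by (simp add: m_def ac_simps)
qed

text \<open>
  In \<open>y i\<close> the numerator contains \<open>s (i - 1)\<close> and the denominator \<open>s (i + 1)\<close>, two places apart, so
  a product of consecutive entries telescopes to two values of \<open>s\<close> at each end.
\<close>

lemma block_y:
  "block y r j * (block x r (j + 1) * (s (j + int r) * s (j + int r + 1))) =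
   block u r j * (block u r (j - 1) * (s j * s (j + 1)))"
proof (induction r)
  case 0
  then show ?case by simp
next
  case (Suc r)
  define m where "m = j + int r + 1"
  have y_m: "y m * (x (m + 1) * s (m + 1)) = u m * (u (m - 1) * s (m - 1))"
    by (rule y_mult)
  have "block y (Suc r) j * (block x (Suc r) (j + 1) * (s m * s (m + 1))) =
      block y r j * (block x r (j + 1) * s m) * (y m * (x (m + 1) * s (m + 1)))"
    by (simp add: block_Suc m_def ac_simps)
  also have "\<dots> = block y r j * (block x r (j + 1) * (s (m - 1) * s m)) * (u m * u (m - 1))"
    unfolding y_m by (simp only: ac_simps)
  also have "\<dots> = block u r j * (block u r (j - 1) * (s j * s (j + 1))) * (u m * u (m - 1))"
    using Suc by (simp add: m_def)
  also have "\<dots> = block u (Suc r) j * (block u (Suc r) (j - 1) * (s j * s (j + 1)))"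
    by (simp add: block_Suc m_def ac_simps)
  finally show ?case
    by (simp add: m_def ac_simps)
qed

text \<open>
  By \<open>block_y\<close>, the terms of \<open>t\<^bsub>r,j\<^esub>\<close> for \<open>y\<close> have denominators \<open>s (j + k) * s (j + k + 1)\<close>;
  still the sum telescopes to the single denominator \<open>s (j + r + 1)\<close>, since \<open>exchange_long\<close> says,
  up to common factors, that adding the next term to one value of the closed form yields the next
  value.
\<close>

lemma tsum_y:
  "tsum u y r j * (block x r (j + 1) * s (j + int r + 1)) =
   block u r j * (s (j + 1) * tsum u x r j)"
proof (induction r)
  case 0
  then show ?case by simp
next
  case (Suc r)
  define m where "m = j + int r + 1"
  let ?X = "block x (Suc r) (j + 1)" and ?U = "block u (Suc r) j"
  have IH: "tsum u y r j * (block x r (j + 1) * s m) = block u r j * (s (j + 1) * tsum u x r j)"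
    using Suc by (simp add: m_def)
  have X: "?X = block x r (j + 1) * x (m + 1)" and U: "?U = block u r j * u m"
    by (simp_all add: block_Suc m_def ac_simps)
  have y: "block y (Suc r) j * (?X * (s m * s (m + 1))) =
      ?U * (block u (Suc r) (j - 1) * (s j * s (j + 1)))"
    using block_y[of "Suc r" j] by (simp add: m_def ac_simps)
  have ex: "tsum u x (Suc r) j * s m =
      x (m + 1) * s (m + 1) * tsum u x r j + block u (Suc r) (j - 1) * s j"
    using exchange_long[of r j] by (simp add: m_def ac_simps)
  have "tsum u y (Suc r) j * (?X * s (m + 1)) * s m =
      tsum u y r j * (block x r (j + 1) * s m) * (u m * (x (m + 1) * s (m + 1)))
      + block y (Suc r) j * (?X * (s m * s (m + 1)))"
    unfolding tsum_Suc[of u y r j] m_def[symmetric] X distrib_right by (simp only: ac_simps)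
  also have "\<dots> = ?U * (s (j + 1) *
      (x (m + 1) * s (m + 1) * tsum u x r j + block u (Suc r) (j - 1) * s j))"
    unfolding IH y by (simp only: U distrib_left ac_simps)
  also have "\<dots> = ?U * (s (j + 1) * tsum u x (Suc r) j) * s m"
    unfolding ex[symmetric] by (simp only: ac_simps)
  finally have "tsum u y (Suc r) j * (?X * s (m + 1)) = ?U * (s (j + 1) * tsum u x (Suc r) j)"
    by (simp only: semifield_cancel_right)
  then show ?case
    by (simp add: m_def ac_simps)
qed

lemma periodic_pair_y: "periodic_pair n u y"
  by unfold_locales (simp_all add: n_pos u_period y_period)

text \<open>
  This is \<open>tsum_y\<close> for \<open>r = n - 1\<close>: there periodicity turns \<open>s (j + r + 1)\<close> into \<open>s j\<close>, which
  cancels, and multiplying by \<open>u j\<close> and \<open>x (j + 1)\<close> completes the two blocks to \<open>A\<close> and \<open>B\<close>.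
\<close>

lemma s_of_y: "u j * periodic_pair.s n u y j * B = A * (x (j + 1) * s (j + 1))"
proof -
  let ?s' = "periodic_pair.s n u y"
  obtain r where n: "n = Suc r"
    using n_pos gr0_conv_Suc by blast
  then have r: "n - 1 = r"
    by simp
  have A: "u j * block u r j = A"
    using block_Suc_left[of u r "j - 1"] block_period[of u n "j - 1", OF u_period] n by simp
  have B: "x (j + 1) * block x r (j + 1) = B"
    using block_Suc_left[of x r j] block_period[of x n j, OF x_period] n by simp
  have "s (j + int r + 1) = s j"
    using s_period[of j] n by (simp add: ac_simps)
  then have eq: "?s' j * (block x r (j + 1) * s j) = block u r j * (s (j + 1) * s j)"
    using tsum_y[of r j] by (simp only: periodic_pair.s_def[OF periodic_pair_y] s_def r)
  have "u j * ?s' j * B * s j = u j * x (j + 1) * (?s' j * (block x r (j + 1) * s j))"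
    unfolding B[symmetric] by (simp only: ac_simps)
  also have "\<dots> = A * (x (j + 1) * s (j + 1)) * s j"
    unfolding eq A[symmetric] by (simp only: ac_simps)
  finally show ?thesis
    by (simp only: semifield_cancel_right)
qed

lemma y_of_y: "periodic_pair.y n u y i = x i"
proof -
  let ?s' = "periodic_pair.s n u y" and ?x' = "periodic_pair.y n u y"
  have prev: "u (i - 1) * ?s' (i - 1) * B = A * (x i * s i)"
    using s_of_y[of "i - 1"] by simp
  have y_next: "y (i + 1) * (x (i + 1 + 1) * s (i + 1 + 1)) = u (i + 1) * (u i * s i)"
    using y_mult[of "i + 1"] by simp
  have "?x' i * (A * (u (i + 1) * (u i * s i)))
      = ?x' i * y (i + 1) * (A * (x (i + 1 + 1) * s (i + 1 + 1)))"
    unfolding y_next[symmetric] by (simp only: ac_simps)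
  also have "\<dots> = (?x' i * (y (i + 1) * ?s' (i + 1))) * (u (i + 1) * B)"
    unfolding s_of_y[of "i + 1", symmetric] by (simp only: ac_simps)
  also have "\<dots> = u i * u (i + 1) * (u (i - 1) * ?s' (i - 1) * B)"
    unfolding periodic_pair.y_mult[OF periodic_pair_y] by (simp only: ac_simps)
  also have "\<dots> = x i * (A * (u (i + 1) * (u i * s i)))"
    unfolding prev by (simp only: ac_simps)
  finally show ?thesis
    by (simp only: semifield_cancel_right)
qed

end

section \<open>From periodic sequences to tuples\<close>

lemma entry_period: "entry n a (i + int n) = entry n a i"
  by (simp add: entry_def cyc_index_def cong_def)

lemma entry_in_range: "i \<in> {1..int n} \<Longrightarrow> entry n a i = a i"
  by (simp add: entry_def cyc_index_eq)

lemma periodic_pair_entry: "n > 0 \<Longrightarrow> periodic_pair n (entry n u) (entry n x)"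
  by unfold_locales (auto simp: entry_period)

lemma entry_f_map:
  assumes "n > 0"
  shows "entry n (f_map n u x) = periodic_pair.y n (entry n u) (entry n x)"
proof
  fix i
  interpret periodic_pair n "entry n u" "entry n x"
    using assms by (rule periodic_pair_entry)
  let ?c = "cyc_index n i"
  have c: "?c \<in> {1..int n}" "[?c = i] (mod int n)"
    using theI'[OF cyc_index_unique[OF assms, of i]] by (auto simp: cyc_index_def)
  obtain k where k: "i = ?c + int n * k"
    using c(2) by (metis cong_iff_lin)
  have shift: "y (j + int n * k) = y j" for j
  proof (induction k rule: int_induct[where k = 0])
    case (step1 k)
    then show ?case using y_period[of "j + int n * k"] by (simp add: algebra_simps)
  next
    case (step2 k)
    then show ?case using y_period[of "j + int n * (k - 1)"] by (simp add: algebra_simps)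
  qed simp
  have "entry n (f_map n u x) i = f_map n u x ?c"
    by (simp add: entry_def)
  also have "\<dots> = y ?c"
    using c(1) by (simp add: f_map_def y_def s_def t_elem_eq_tsum)
  also have "\<dots> = y i"
    using shift[of ?c] k by simp
  finally show "entry n (f_map n u x) i = y i" .
qed

lemma f_map_in_tuples: "f_map n u x \<in> tuples n"
  by (simp add: f_map_def tuples_def)

lemma f_map_involution:
  assumes "n > 0" and "x \<in> tuples n"
  shows "f_map n u (f_map n u x) = x"
proof (rule PiE_ext)
  interpret periodic_pair n "entry n u" "entry n x"
    using assms(1) by (rule periodic_pair_entry)
  show "f_map n u (f_map n u x) \<in> {1..int n} \<rightarrow>\<^sub>E UNIV"
    using f_map_in_tuples by (simp add: tuples_def)
  show "x \<in> {1..int n} \<rightarrow>\<^sub>E UNIV"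
    using assms(2) by (simp add: tuples_def)
  fix i assume i: "i \<in> {1..int n}"
  have "entry n (f_map n u (f_map n u x)) i = entry n x i"
    using assms(1) by (simp add: entry_f_map y_of_y)
  then show "f_map n u (f_map n u x) i = x i"
    using i by (simp only: entry_in_range)
qed

theorem theorem3p11:
  fixes n :: nat and u :: "int \<Rightarrow> 'a::semifield"
  assumes "n > 0" and "u \<in> tuples n"
  shows
    "(f_map n u \<in> tuples n \<rightarrow> tuples n \<and>
      (\<forall>x\<in>tuples n. f_map n u (f_map n u x) = x)) \<and>
     (\<forall>x\<in>tuples n. \<forall>y\<in>tuples n. y = f_map n u x \<longrightarrow>
        (\<Prod>i\<in>{1..int n}. entry n y i) * (\<Prod>i\<in>{1..int n}. entry n x i) =
        (\<Prod>i\<in>{1..int n}. entry n u i) ^ 2) \<and>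
     (\<forall>x\<in>tuples n. \<forall>y\<in>tuples n. y = f_map n u x \<longrightarrow>
        (\<forall>i::int.
          (entry n u i + entry n x i) * (1 / entry n u (i + 1) + 1 / entry n x (i + 1)) =
          (entry n u i + entry n y i) * (1 / entry n u (i + 1) + 1 / entry n y (i + 1)))) \<and>
     (\<forall>x\<in>tuples n. \<forall>y\<in>tuples n. y = f_map n u x \<longrightarrow>
        (\<Prod>i\<in>{1..int n}. (entry n u i + entry n x i) / entry n x i) =
        (\<Prod>i\<in>{1..int n}. (entry n u i + entry n y i) / entry n u i))"
proof (intro conjI ballI impI allI)
  show "f_map n u \<in> tuples n \<rightarrow> tuples n"
    using f_map_in_tuples by blast
next
  fix x :: "int \<Rightarrow> 'a" assume "x \<in> tuples n"
  then show "f_map n u (f_map n u x) = x"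
    using assms(1) by (rule f_map_involution[rotated])
next
  fix x y :: "int \<Rightarrow> 'a" assume y: "y = f_map n u x"
  interpret periodic_pair n "entry n u" "entry n x"
    using assms(1) by (rule periodic_pair_entry)
  show "(\<Prod>i\<in>{1..int n}. entry n y i) * (\<Prod>i\<in>{1..int n}. entry n x i) =
      (\<Prod>i\<in>{1..int n}. entry n u i) ^ 2"
    using prod_y assms(1) by (simp add: y entry_f_map)
next
  fix x y :: "int \<Rightarrow> 'a" and i :: int assume y: "y = f_map n u x"
  interpret periodic_pair n "entry n u" "entry n x"
    using assms(1) by (rule periodic_pair_entry)
  show
    "(entry n u i + entry n x i) * (1 / entry n u (i + 1) + 1 / entry n x (i + 1)) =
     (entry n u i + entry n y i) * (1 / entry n u (i + 1) + 1 / entry n y (i + 1))"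
    using local_invariant assms(1) by (simp add: y entry_f_map)
next
  fix x y :: "int \<Rightarrow> 'a" assume y: "y = f_map n u x"
  interpret periodic_pair n "entry n u" "entry n x"
    using assms(1) by (rule periodic_pair_entry)
  show "(\<Prod>i\<in>{1..int n}. (entry n u i + entry n x i) / entry n x i) =
      (\<Prod>i\<in>{1..int n}. (entry n u i + entry n y i) / entry n u i)"
    using prod_ratio assms(1) by (simp add: y entry_f_map)
qed

end
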